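(* Let $n\geq 1$ and $\delta \in (0, 1/4)$. Let $X_1,\ldots, X_n$ be independent and identically distributed random variables on $\mathbb R$ with density $f_X$ with respect to Lebesgue measure. Let $K:\mathbb R\to\mathbb R_{\geq 0}$ satisfy, for all $u\in\mathbb R$, $$K(u) = F(u)\,\mathbf 1_A(u) + (1-G(u))\,\mathbf 1_{A^c}(u),$$ where $A=\bigcup_{j=1}^q(a_j,b_j]$ for some integer $q\geq 1$ and $-\infty=a_1<b_1<a_2<b_2<\cdots<a_q<b_q<+\infty$, where $F,G:\mathbb R\to[0,1]$, where $F$ is nondecreasing on each interval of $A$ and $G$ is nondecreasing on each interval of $A^c$. (1) Let $h>0$ and let $D$ be a countable dense subset of $\mathbb R$. With probability at least $1-2\delta$, for all $x \in D$, $$ | \hat f_{n,h} (x) - f_h(x) | \leq \sqrt{ \frac{ 24q }{nh} \left( \hat f_{n,h}(x) \wedge f_h(x) \right) \log\left( \frac{ 3n}{\delta}\right) } + \frac{ 72q }{nh} \log\left( \frac{ 3n}{\delta}\right) .$$ (2) If, in addition, $F$ is left-continuous on each interval of $A$ and $G$ is right-continuous on each interval of $A^c$, then, for $D'$ a countable dense subset of $\mathbb R\times(0,+\infty)$, with probability at least $1-2\delta$, for all $(x,h)\in D'$, $$ | \hat f_{n,h} (x) - f_h(x) | \leq \sqrt{ \frac{ 40q }{nh} \left( \hat f_{n,h}(x) \wedge f_h(x) \right) \log\left( \frac{ 3n}{\delta}\right) } + \frac{ 120q }{nh} \log\left( \frac{ 3n}{\delta}\right) .$$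
   Context: For $h>0$, $K_h(u)=h^{-1}K(u/h)$. The kernel density estimator with bandwidth $h$ is $\hat f_{n,h}(x)=n^{-1}\sum_{i=1}^n K_h(x-X_i)$, and the smoothed density is $f_h(x)=(f_X\ast K_h)(x)=\int f_X(x-y)K_h(y)\,dy$. $a\wedge b$ denotes $\min(a,b)$. $A^c=\mathbb R\setminus A$. The intervals of $A$ are $(a_j,b_j]$, $j=1,\dots,q$; the intervals of $A^c$ are $(b_j,a_{j+1}]$ for $j=1,\dots,q-1$ and $(b_q,+\infty)$. Left- or right-continuity on an interval is understood for the function restricted to that interval. *)

theory Defs
  imports "HOL-Probability.Probability"
begin

definition scaled_kernel :: "(real \<Rightarrow> real) \<Rightarrow> real \<Rightarrow> real \<Rightarrow> real" where
  "scaled_kernel K h u = inverse h * K (u / h)"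

text \<open>The sample is a function on the index set \<open>{1..n}\<close>.\<close>

definition kde :: "(real \<Rightarrow> real) \<Rightarrow> nat \<Rightarrow> real \<Rightarrow> (nat \<Rightarrow> real) \<Rightarrow> real \<Rightarrow> real" where
  "kde K n h xs x = inverse (real n) * (\<Sum>i = 1..n. scaled_kernel K h (x - xs i))"

definition smoothed_density :: "(real \<Rightarrow> real) \<Rightarrow> (real \<Rightarrow> real) \<Rightarrow> real \<Rightarrow> real \<Rightarrow> real" where
  "smoothed_density f K h x = (LINT y|lborel. f (x - y) * scaled_kernel K h y)"

text \<open>
  The left endpoints are extended reals because the first one is \<open>- \<infinity>\<close>; the right endpoints
  are all finite.
\<close>

definition endpoints :: "nat \<Rightarrow> (nat \<Rightarrow> ereal) \<Rightarrow> (nat \<Rightarrow> real) \<Rightarrow> bool" where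
  "endpoints q a b \<longleftrightarrow>
     a 1 = - \<infinity> \<and>
     (\<forall>j\<in>{1..q}. a j < ereal (b j)) \<and>
     (\<forall>j\<in>{1..<q}. ereal (b j) < a (j + 1))"

definition inner_interval :: "(nat \<Rightarrow> ereal) \<Rightarrow> (nat \<Rightarrow> real) \<Rightarrow> nat \<Rightarrow> real set" where
  "inner_interval a b j = {u. a j < ereal u \<and> u \<le> b j}"

text \<open>The intervals of the complement; the last one is unbounded to the right.\<close>

definition outer_interval :: "nat \<Rightarrow> (nat \<Rightarrow> ereal) \<Rightarrow> (nat \<Rightarrow> real) \<Rightarrow> nat \<Rightarrow> real set" where
  "outer_interval q a b j =
     (if j < q then {u. b j < u \<and> ereal u \<le> a (j + 1)} else {b q<..})"

text \<open>
  One-sided continuity of the restriction of a function to a set: at a point that the set does not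
  approach from the relevant side, the limit filter is trivial and nothing is required.
\<close>

definition left_continuous_on :: "real set \<Rightarrow> (real \<Rightarrow> real) \<Rightarrow> bool" where
  "left_continuous_on I g \<longleftrightarrow> (\<forall>u\<in>I. (g \<longlongrightarrow> g u) (at u within (I \<inter> {..<u})))"

definition right_continuous_on :: "real set \<Rightarrow> (real \<Rightarrow> real) \<Rightarrow> bool" where
  "right_continuous_on I g \<longleftrightarrow> (\<forall>u\<in>I. (g \<longlongrightarrow> g u) (at u within (I \<inter> {u<..})))"

end

theory Submission imports Defs begin

text \<open>
  The kernel increases up to \<open>b j\<close> and decreases afterwards on each of \<open>q\<close> pieces of the line, so
  each of its superlevel sets is a disjoint union of at most \<open>q\<close> intervals, and this survives the
  substitution \<open>z \<mapsto> (x - z) / h\<close> for all \<open>x\<close> and \<open>h\<close>. It therefore suffices to control, on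
  one event, the number of observations in every interval \<open>S\<close> by the probability of \<open>S\<close>; the
  bound for the estimator then holds simultaneously for all locations and all bandwidths
  (\<open>kde_uniform_deviation\<close>).

  \<^bold>\<open>Intervals.\<close> The law of the observations has no atoms, so there are quantiles of every
  order \<open>i / n\<close>. The number of observations in the difference of two quantile half-lines is
  binomial, and Chernoff's bound (\<open>count_deviation\<close>) gives a deviation of at most
  \<open>2 * sqrt (m * l) + l\<close> from its mean \<open>m\<close>, except with probability \<open>2 * exp (- l)\<close>. With
  \<open>l = 2 * ln (3 * n / \<delta>)\<close> a union bound over the \<open>(n + 1)\<^sup>2\<close> differences costs less than
  \<open>2 * \<delta>\<close>. Every nonempty interval is squeezed between two of these differences whose expected counts
  differ by at most 2, and counts are monotone in the set, so all intervals are controlled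
  (\<open>interval_count_deviation\<close>, \<open>uniform_interval_deviation\<close>).

  \<^bold>\<open>Functions.\<close> The square root is replaced by its linear majorants
  \<open>2 * sqrt (m * l) \<le> t * m + l / t\<close>, \<open>t > 0\<close>. Linear bounds can be summed over the \<open>q\<close>
  intervals and averaged over the levels of the kernel
  (\<open>linear_bound_intervals_imp_piecewise_unimodal\<close>). This multiplies only the constant term by
  \<open>q\<close>, and optimising over \<open>t\<close> afterwards recovers a square root with \<open>q\<close> inside
  (\<open>abs_diff_le_sqrt_min\<close>). With \<open>L = ln (3 * n / \<delta>)\<close>, the coefficient of
  \<open>q * L / (n * h)\<close> that comes out is 8 under the root and 24 outside it, which is within the
  constants of both parts of the theorem.
\<close>

section \<open>Deviation of an empirical count\<close>

lemma exp_le_one_plus_self_plus_square: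
  fixes s :: real
  assumes "\<bar>s\<bar> \<le> 1"
  shows "exp s \<le> 1 + s + s\<^sup>2"
proof (cases "0 \<le> s")
  case True
  then show ?thesis using assms by (intro exp_bound) auto
next
  case False
  define r where "r = - s"
  have r: "0 < r" "r \<le> 1" using False assms by (auto simp: r_def)
  have "exp s = 1 / exp r" by (simp add: r_def exp_minus field_simps)
  also have "\<dots> \<le> 1 / (1 + r)"
    using r exp_ge_add_one_self[of r] by (intro divide_left_mono) auto
  also have "\<dots> \<le> 1 - r + r\<^sup>2"
  proof -
    have "(1 - r + r\<^sup>2) * (1 + r) = 1 + r ^ 3"
      by (simp add: power2_eq_square power3_eq_cube algebra_simps)
    then have "1 \<le> (1 - r + r\<^sup>2) * (1 + r)" using r by simp
    then show ?thesis using r by (simp add: divide_le_eq)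
  qed
  finally show ?thesis by (simp add: r_def)
qed

text \<open>
  Chernoff's bound for a binomial count, with the tilting parameter \<open>s\<close> still free; a positive
  \<open>s\<close> controls the upper tail and a negative one the lower tail.
\<close>

lemma (in prob_space) count_exponential_tail:
  fixes X :: "'i \<Rightarrow> 'a \<Rightarrow> 'b"
  assumes indep: "indep_vars (\<lambda>_. N) X I" and fin: "finite I" and B: "B \<in> sets N"
    and p: "\<And>i. i \<in> I \<Longrightarrow> prob (X i -` B \<inter> space M) = p"
    and p0: "0 \<le> p" and s: "\<bar>s\<bar> \<le> 1"
  defines "m \<equiv> real (card I) * p"
  shows "prob {\<omega> \<in> space M. s * (\<Sum>i\<in>I. indicat_real B (X i \<omega>)) \<ge> s * m + s\<^sup>2 * m + l} \<le> exp (- l)"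
proof -
  define Z where "Z i \<omega> = exp (s * indicat_real B (X i \<omega>))" for i \<omega>
  have X[measurable]: "X i \<in> measurable M N" if "i \<in> I" for i
    using indep that by (auto simp: indep_vars_def)
  note B[measurable]
  have Zm: "Z i \<in> borel_measurable M" if "i \<in> I" for i
    unfolding Z_def using X[OF that] by measurable
  have Zint: "integrable M (Z i)" if "i \<in> I" for i
    by (rule integrable_const_bound[where B = "exp \<bar>s\<bar>"])
      (use Zm that in \<open>auto simp: Z_def indicator_def abs_if\<close>)
  have EZ: "expectation (Z i) \<le> exp (p * (s + s\<^sup>2))" if i: "i \<in> I" for i
  proof -
    have Zeq: "Z i \<omega> = 1 + (exp s - 1) * indicat_real (X i -` B \<inter> space M) \<omega>"
      if "\<omega> \<in> space M" for \<omega>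
      using that by (auto simp: Z_def indicator_def)
    have ev: "X i -` B \<inter> space M \<in> events" using X[OF i] by measurable
    have "expectation (Z i) = expectation (\<lambda>\<omega>. 1 + (exp s - 1) * indicat_real (X i -` B \<inter> space M) \<omega>)"
      by (intro Bochner_Integration.integral_cong refl Zeq)
    also have "\<dots> = 1 + (exp s - 1) * p"
      using ev by (subst Bochner_Integration.integral_add)
        (auto simp: prob_space p[OF i] less_top[symmetric])
    also have "\<dots> \<le> 1 + (s + s\<^sup>2) * p"
      using exp_le_one_plus_self_plus_square[OF s] p0
      by (intro add_left_mono mult_right_mono) auto
    also have "\<dots> \<le> exp (p * (s + s\<^sup>2))"
      using exp_ge_add_one_self[of "p * (s + s\<^sup>2)"] by (simp add: mult.commute)
    finally show ?thesis .
  qed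
  have EZ0: "0 \<le> expectation (Z i)" for i
    by (intro Bochner_Integration.integral_nonneg) (simp add: Z_def)
  have indZ: "indep_vars (\<lambda>_. borel) Z I"
    unfolding Z_def
    by (rule indep_vars_compose2[OF indep, where Y = "\<lambda>_ z. exp (s * indicat_real B z)"]) measurable
  define W where "W \<omega> = exp (s * (\<Sum>i\<in>I. indicat_real B (X i \<omega>)))" for \<omega>
  have W: "W = (\<lambda>\<omega>. \<Prod>i\<in>I. Z i \<omega>)"
    by (simp add: W_def Z_def fun_eq_iff exp_sum[OF fin, symmetric] sum_distrib_left)
  have Wint: "integrable M W"
    unfolding W by (rule indep_vars_integrable[OF fin indZ Zint])
  have "expectation W = (\<Prod>i\<in>I. expectation (Z i))"
    unfolding W by (rule indep_vars_lebesgue_integral[OF fin indZ Zint])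
  also have "\<dots> \<le> (\<Prod>i\<in>I. exp (p * (s + s\<^sup>2)))"
    by (intro prod_mono) (use EZ EZ0 in auto)
  also have "\<dots> = exp (s * m + s\<^sup>2 * m)"
    by (simp add: m_def exp_of_nat_mult[symmetric] algebra_simps)
  finally have EW: "expectation W \<le> exp (s * m + s\<^sup>2 * m)" .
  have "prob {\<omega> \<in> space M. s * (\<Sum>i\<in>I. indicat_real B (X i \<omega>)) \<ge> s * m + s\<^sup>2 * m + l}
      = prob {\<omega> \<in> space M. W \<omega> \<ge> exp (s * m + s\<^sup>2 * m + l)}"
    by (simp add: W_def)
  also have "\<dots> \<le> expectation W / exp (s * m + s\<^sup>2 * m + l)"
    by (rule integral_Markov_inequality_measure[OF Wint, of "{}"]) (auto simp: W_def)
  also have "\<dots> \<le> exp (s * m + s\<^sup>2 * m) / exp (s * m + s\<^sup>2 * m + l)"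
    by (intro divide_right_mono EW) simp
  also have "\<dots> = exp (- l)" by (simp add: exp_diff[symmetric])
  finally show ?thesis .
qed

text \<open>
  The tilting parameter \<open>sqrt (l / m)\<close> balances the two terms \<open>s * m\<close> and \<open>l / s\<close>; it is cut off
  at 1, the range of the quadratic bound on the exponential. The deviation is of order
  \<open>sqrt (m * l)\<close> rather than \<open>sqrt (n * l)\<close>, and this is what makes the final estimate relative.
\<close>

lemma (in prob_space) count_deviation:
  fixes X :: "'i \<Rightarrow> 'a \<Rightarrow> 'b"
  assumes indep: "indep_vars (\<lambda>_. N) X I" and fin: "finite I" and B: "B \<in> sets N"
    and p: "\<And>i. i \<in> I \<Longrightarrow> prob (X i -` B \<inter> space M) = p"
    and p0: "0 \<le> p" and l: "0 \<le> l"
  defines "m \<equiv> real (card I) * p"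
  shows "prob {\<omega> \<in> space M. \<not> \<bar>(\<Sum>i\<in>I. indicat_real B (X i \<omega>)) - m\<bar> \<le> 2 * sqrt (m * l) + l}
    \<le> 2 * exp (- l)"
proof -
  have m0: "0 \<le> m" using p0 by (simp add: m_def)
  define s where "s = (if m \<le> l then 1 else sqrt (l / m))"
  define r where "r = 2 * sqrt (m * l) + l"
  have s: "0 \<le> s" "s \<le> 1"
    using m0 l by (auto simp: s_def divide_le_eq)
  have sr: "s\<^sup>2 * m + l \<le> s * r"
  proof (cases "m \<le> l")
    case True
    have "m = sqrt (m * m)" using m0 by simp
    also have "\<dots> \<le> sqrt (m * l)" using True m0 by (intro real_sqrt_le_mono mult_left_mono)
    finally show ?thesis using True m0 l by (simp add: s_def r_def)
  next
    case False
    then have mpos: "0 < m" using l by simp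
    have "sqrt (l / m) * sqrt (m * l) = l"
      using mpos l by (simp add: real_sqrt_mult[symmetric])
    then have "s * r = 2 * l + s * l"
      using False by (simp add: s_def r_def algebra_simps)
    moreover have "s\<^sup>2 * m = l" using False mpos l by (simp add: s_def)
    ultimately show ?thesis using s l by simp
  qed
  let ?S = "\<lambda>\<omega>. (\<Sum>i\<in>I. indicat_real B (X i \<omega>))"
  let ?U = "{\<omega> \<in> space M. s * ?S \<omega> \<ge> s * m + s\<^sup>2 * m + l}"
  let ?L = "{\<omega> \<in> space M. - s * ?S \<omega> \<ge> - s * m + (- s)\<^sup>2 * m + l}"
  have X[measurable]: "X i \<in> measurable M N" if "i \<in> I" for i
    using indep that by (auto simp: indep_vars_def)
  note B[measurable]
  have S[measurable]: "?S \<in> borel_measurable M"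
    by (intro borel_measurable_sum) measurable
  have "prob {\<omega> \<in> space M. \<not> \<bar>?S \<omega> - m\<bar> \<le> r} \<le> prob (?U \<union> ?L)"
  proof (rule finite_measure_mono)
    show "{\<omega> \<in> space M. \<not> \<bar>?S \<omega> - m\<bar> \<le> r} \<subseteq> ?U \<union> ?L"
    proof
      fix \<omega> assume "\<omega> \<in> {\<omega> \<in> space M. \<not> \<bar>?S \<omega> - m\<bar> \<le> r}"
      then have \<omega>: "\<omega> \<in> space M" and "r < ?S \<omega> - m \<or> r < m - ?S \<omega>" by auto
      then have "s * r \<le> s * (?S \<omega> - m) \<or> s * r \<le> s * (m - ?S \<omega>)"
        using s by (auto intro!: mult_left_mono)
      then show "\<omega> \<in> ?U \<union> ?L" using \<omega> sr by (auto simp: algebra_simps)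
    qed
  qed measurable
  also have "\<dots> \<le> prob ?U + prob ?L" by (rule measure_Un_le) measurable
  also have "\<dots> \<le> exp (- l) + exp (- l)"
    unfolding m_def using s
    by (intro add_mono count_exponential_tail[OF indep fin B p p0]) auto
  finally show ?thesis by (simp add: r_def)
qed

section \<open>From a grid of quantiles to all intervals\<close>

text \<open>
  Half-lines at the quantiles of order \<open>i / n\<close>. They are described only as down-closed sets, which
  lets the empty set and the whole line stand for the infinite quantiles of order 0 and 1.
\<close>

lemma (in real_distribution) quantile_down_sets:
  assumes atomless: "\<And>x. measure M {x} = 0" and n: "0 < (n::nat)"
  obtains D :: "nat \<Rightarrow> real set"
  where "D 0 = {}" "D n = UNIV" "\<And>i. D i \<in> sets borel"
    "\<And>i x y. y \<in> D i \<Longrightarrow> x \<le> y \<Longrightarrow> x \<in> D i"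
    "\<And>i. i \<le> n \<Longrightarrow> measure M (D i) = real i / real n"
proof -
  have ex: "\<exists>x. cdf M x = t" if t: "0 < t" "t < 1" for t
  proof -
    have "eventually (\<lambda>x. cdf M x < t) at_bot"
      using cdf_lim_at_bot t by (simp add: order_tendsto_iff)
    then obtain x0 where x0: "\<And>x. x \<le> x0 \<Longrightarrow> cdf M x < t" by (auto simp: eventually_at_bot_linorder)
    have "eventually (\<lambda>x. cdf M x > t) at_top"
      using cdf_lim_at_top_prob t by (simp add: order_tendsto_iff)
    then obtain x1 where x1: "\<And>x. x \<ge> x1 \<Longrightarrow> cdf M x > t" by (auto simp: eventually_at_top_linorder)
    have "\<exists>x\<ge>min x0 x1. x \<le> x1 \<and> cdf M x = t"
      using x0[of "min x0 x1"] x1[of x1] atomless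
      by (intro IVT) (auto simp: isCont_cdf)
    then show ?thesis by blast
  qed
  define g where "g t = (SOME x. cdf M x = t)" for t
  have g: "cdf M (g t) = t" if "0 < t" "t < 1" for t
    unfolding g_def by (rule someI_ex[OF ex[OF that]])
  define D where "D i = (if i = 0 then {} else if n \<le> i then UNIV else {..g (real i / real n)})" for i
  show ?thesis
  proof
    show "measure M (D i) = real i / real n" if "i \<le> n" for i
      using that n g[of "real i / real n"] prob_space by (auto simp: D_def cdf_def)
  qed (use n in \<open>auto simp: D_def split: if_splits\<close>)
qed

text \<open>
  An interval \<open>S\<close> lies in some \<open>D j - D i\<close> and contains \<open>D (j - 1) - D (i + 1)\<close>, and both
  differ from \<open>S\<close> by at most \<open>2 / n\<close> in probability. As \<open>n\<close> is also the sample size, the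
  discretisation costs at most 2 in terms of expected counts; the terms that this adds to the deviation
  are bounded by multiples of \<open>l\<close> because \<open>l \<ge> 2\<close>.
\<close>

lemma (in real_distribution) interval_count_deviation:
  fixes x :: "'i \<Rightarrow> real" and D :: "nat \<Rightarrow> real set"
  assumes fin: "finite I" and ne: "I \<noteq> {}"
  defines "n \<equiv> card I"
  assumes D0: "D 0 = {}" and Dn: "D n = UNIV" and Dm: "\<And>i. D i \<in> sets borel"
    and Dd: "\<And>i x y. y \<in> D i \<Longrightarrow> x \<le> y \<Longrightarrow> x \<in> D i"
    and DM: "\<And>i. i \<le> n \<Longrightarrow> measure M (D i) = real i / real n"
    and grid: "\<And>i j. i \<le> n \<Longrightarrow> j \<le> n \<Longrightarrow>
      \<bar>(\<Sum>k\<in>I. indicat_real (D j - D i) (x k)) - real n * measure M (D j - D i)\<bar>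
        \<le> 2 * sqrt (real n * measure M (D j - D i) * l) + l"
    and l: "2 \<le> l" and S: "is_interval S"
  shows "\<bar>(\<Sum>k\<in>I. indicat_real S (x k)) - real n * measure M S\<bar>
    \<le> 2 * sqrt (real n * measure M S * l) + 4 * l"
proof (cases "S = {}")
  case True
  then show ?thesis using l by simp
next
  case False
  have n: "0 < n" using fin ne by (simp add: n_def card_gt_0_iff)
  have Sm: "S \<in> sets borel" by (rule real_interval_borel_measurable[OF S])
  have mono: "D i \<subseteq> D j" if "i \<le> j" "j \<le> n" for i j
  proof (rule ccontr)
    assume "\<not> D i \<subseteq> D j"
    then obtain z where z: "z \<in> D i" "z \<notin> D j" by auto
    have "D j \<subseteq> D i"
    proof
      fix y assume "y \<in> D j"
      then have "y \<le> z" using z Dd[of y j z] by force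
      then show "y \<in> D i" using z Dd by blast
    qed
    then have "measure M (D j) \<le> measure M (D i)"
      using Dm by (intro finite_measure_mono) auto
    then have "i = j" using DM[of i] DM[of j] that n by (simp add: divide_le_cancel)
    then show False using \<open>\<not> D i \<subseteq> D j\<close> by simp
  qed
  have diff: "real n * measure M (D j - D i) = real j - real i" if "i \<le> j" "j \<le> n" for i j
    using finite_measure_Diff[of "D j" "D i"] mono[OF that] that DM[of i] DM[of j] Dm n
    by (simp add: field_simps)
  define i where "i = Max {i. i \<le> n \<and> S \<inter> D i = {}}"
  define j where "j = Min {j. j \<le> n \<and> S \<subseteq> D j}"
  have fi: "finite {i. i \<le> n \<and> S \<inter> D i = {}}" and fj: "finite {j. j \<le> n \<and> S \<subseteq> D j}" by auto
  have "i \<in> {i. i \<le> n \<and> S \<inter> D i = {}}"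
    unfolding i_def using D0 by (intro Max_in fi) auto
  then have i: "i \<le> n" "S \<inter> D i = {}" by auto
  have "j \<in> {j. j \<le> n \<and> S \<subseteq> D j}"
    unfolding j_def using Dn by (intro Min_in fj) auto
  then have j: "j \<le> n" "S \<subseteq> D j" by auto
  have imax: "k \<le> i" if "k \<le> n" "S \<inter> D k = {}" for k
    unfolding i_def using that by (intro Max_ge fi) auto
  have jmin: "j \<le> k" if "k \<le> n" "S \<subseteq> D k" for k
    unfolding j_def using that by (intro Min_le fj) auto
  have ij: "i < j"
  proof (rule ccontr)
    assume "\<not> i < j"
    then have "D j \<subseteq> D i" using mono[of j i] i by simp
    then show False using i j False by auto
  qed
  \<comment> \<open>Two points of \<open>S\<close>, one on each side of the inner difference, from the extremality of \<open>i\<close> and \<open>j\<close>.\<close>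
  obtain s where s: "s \<in> S" "s \<in> D (Suc i)"
    using imax[of "Suc i"] ij j by (metis Suc_leI disjoint_iff le_trans not_less_eq_eq order_refl)
  obtain s' where s': "s' \<in> S" "s' \<notin> D (j - 1)"
    using jmin[of "j - 1"] ij j by fastforce
  have inner: "D (j - 1) - D (Suc i) \<subseteq> S"
  proof
    fix z assume z: "z \<in> D (j - 1) - D (Suc i)"
    have "s \<le> z" using Dd[of s "Suc i" z] s z by force
    moreover have "z \<le> s'" using Dd[of z "j - 1" s'] s' z by force
    ultimately show "z \<in> S" using S s s' unfolding is_interval_1 by blast
  qed
  have outer: "S \<subseteq> D j - D i" using i j by auto
  define c where "c T = (\<Sum>k\<in>I. indicat_real T (x k))" for T
  define m where "m = real n * measure M S"
  have c0: "0 \<le> c T" for T unfolding c_def by (intro sum_nonneg) simp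
  have c_mono: "c T \<le> c T'" if "T \<subseteq> T'" for T T'
    unfolding c_def using that by (intro sum_mono) (auto simp: indicator_def)
  have m0: "0 \<le> m" by (simp add: m_def)
  have m_outer: "m \<le> real j - real i"
    unfolding m_def diff[OF less_imp_le[OF ij] j(1), symmetric]
    using outer Dm by (intro mult_left_mono finite_measure_mono) auto
  have m_inner: "real j - real i - 2 \<le> m"
  proof (cases "Suc i \<le> j - 1")
    case True
    have "real (j - 1) - real (Suc i) \<le> m"
      unfolding m_def diff[OF True diff_le_self[THEN le_trans, OF j(1)], symmetric]
      using inner Sm by (intro mult_left_mono finite_measure_mono) auto
    then show ?thesis using ij by simp
  next
    case False
    then have "real j \<le> real i + 1" by simp
    then show ?thesis using m0 by simp
  qed
  have sqrt_l: "sqrt (2 * l) \<le> l"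
    using l by (intro real_le_lsqrt) (auto simp: power2_eq_square)
  have upper: "c S - m \<le> 2 * sqrt (m * l) + 4 * l"
  proof -
    have "c S \<le> c (D j - D i)" by (rule c_mono[OF outer])
    also have "\<dots> \<le> (real j - real i) + 2 * sqrt ((real j - real i) * l) + l"
      using grid[OF i(1) j(1)] diff[OF less_imp_le[OF ij] j(1)] by (simp add: c_def)
    also have "\<dots> \<le> (m + 2) + 2 * sqrt ((m + 2) * l) + l"
      using m_inner l by (intro add_mono mult_left_mono real_sqrt_le_mono mult_right_mono) auto
    also have "sqrt ((m + 2) * l) \<le> sqrt (m * l) + sqrt (2 * l)"
      using sqrt_add_le_add_sqrt[of "m * l" "2 * l"] m0 l by (simp add: algebra_simps)
    finally show ?thesis using sqrt_l l by simp
  qed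
  have lower: "m - c S \<le> 2 * sqrt (m * l) + 4 * l"
  proof (cases "Suc i \<le> j - 1")
    case True
    have j1: "j - 1 \<le> n" using j by simp
    define d where "d = real (j - 1) - real (Suc i)"
    have d: "m - 2 \<le> d" "d \<le> m" using m_outer m_inner ij by (auto simp: d_def)
    have "d - (2 * sqrt (d * l) + l) \<le> c (D (j - 1) - D (Suc i))"
      using grid[OF le_trans[OF True j1] j1] diff[OF True j1] by (simp add: c_def d_def)
    also have "\<dots> \<le> c S" by (rule c_mono[OF inner])
    finally have "d - (2 * sqrt (d * l) + l) \<le> c S" .
    moreover have "sqrt (d * l) \<le> sqrt (m * l)"
      using d l by (intro real_sqrt_le_mono mult_right_mono) auto
    ultimately show ?thesis using d l by linarith
  next
    case False
    then have "m \<le> 2" using m_outer by simp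
    then show ?thesis using c0[of S] m0 l real_sqrt_ge_zero[of "m * l"] mult_nonneg_nonneg[of m l] by linarith
  qed
  show ?thesis using upper lower by (simp add: c_def m_def)
qed

section \<open>From intervals to piecewise unimodal functions\<close>

text \<open>
  Each level may miss some of the \<open>q\<close> pieces, since the empty set is an interval. The pieces are
  themselves intervals: let \<open>t\<close> tend to minus infinity.
\<close>

definition piecewise_unimodal :: "nat \<Rightarrow> (real \<Rightarrow> real) \<Rightarrow> bool" where
  "piecewise_unimodal q g \<longleftrightarrow>
    (\<exists>C. disjoint_family_on C {1..q} \<and> (\<Union>j\<in>{1..q}. C j) = UNIV \<and>
      (\<forall>j\<in>{1..q}. \<forall>t. is_interval {z \<in> C j. t \<le> g z}))"

lemma piecewise_unimodal_borel_measurable: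
  assumes "piecewise_unimodal q g"
  shows "g \<in> borel_measurable borel"
proof -
  obtain C where C: "(\<Union>j\<in>{1..q}. C j) = UNIV"
    "\<And>j t. j \<in> {1..q} \<Longrightarrow> is_interval {z \<in> C j. t \<le> g z}"
    using assms by (auto simp: piecewise_unimodal_def)
  have "{z. t \<le> g z} = (\<Union>j\<in>{1..q}. {z \<in> C j. t \<le> g z})" for t using C(1) by blast
  moreover have "(\<Union>j\<in>{1..q}. {z \<in> C j. t \<le> g z}) \<in> sets borel" for t
    by (intro sets.finite_UN real_interval_borel_measurable C(2)) auto
  ultimately have "{z. t \<le> g z} \<in> sets borel" for t by simp
  then show ?thesis by (subst borel_measurable_iff_ge) auto
qed

lemma piecewise_unimodal_reflect_scale:
  assumes "piecewise_unimodal q g" and h: "0 < h"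
  shows "piecewise_unimodal q (\<lambda>z. g ((x - z) / h))"
proof -
  obtain C where C: "disjoint_family_on C {1..q}" "(\<Union>j\<in>{1..q}. C j) = UNIV"
    "\<And>j t. j \<in> {1..q} \<Longrightarrow> is_interval {z \<in> C j. t \<le> g z}"
    using assms by (auto simp: piecewise_unimodal_def)
  define \<phi> where "\<phi> z = (x - z) / h" for z
  have anti: "\<phi> z' \<le> \<phi> z" if "z \<le> z'" for z z'
    using that h by (simp add: \<phi>_def divide_right_mono)
  have "is_interval {z \<in> \<phi> -` C j. t \<le> g (\<phi> z)}" if "j \<in> {1..q}" for j t
    unfolding is_interval_1
  proof (intro ballI allI impI)
    fix u v w assume u: "u \<in> {z \<in> \<phi> -` C j. t \<le> g (\<phi> z)}"
      and v: "v \<in> {z \<in> \<phi> -` C j. t \<le> g (\<phi> z)}" and w: "u \<le> w \<and> w \<le> v"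
    have "\<phi> v \<le> \<phi> w \<and> \<phi> w \<le> \<phi> u" using w anti by blast
    moreover have "\<phi> u \<in> {z \<in> C j. t \<le> g z}" "\<phi> v \<in> {z \<in> C j. t \<le> g z}" using u v by auto
    ultimately have "\<phi> w \<in> {z \<in> C j. t \<le> g z}"
      using C(3)[OF that, of t] unfolding is_interval_1 by blast
    then show "w \<in> {z \<in> \<phi> -` C j. t \<le> g (\<phi> z)}" by simp
  qed
  moreover have "disjoint_family_on (\<lambda>j. \<phi> -` C j) {1..q}"
    using C(1) unfolding disjoint_family_on_def by blast
  moreover have "(\<Union>j\<in>{1..q}. \<phi> -` C j) = UNIV" using C(2) by blast
  ultimately show ?thesis unfolding piecewise_unimodal_def \<phi>_def by blast
qed

text \<open>
  The layer-cake formula \<open>g = integral of 1{t \<le> g} dt\<close>, with the integral replaced by a Riemann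
  sum so that only finite sums of indicators occur. The sum rounds \<open>g\<close> down to a multiple of
  \<open>1 / N\<close>.
\<close>

lemma layer_cake_sum_approx:
  fixes y :: real
  assumes "0 \<le> y" "y \<le> 1" and N: "0 < N"
  shows "\<bar>y - (\<Sum>k\<in>{1..N}. if real k / real N \<le> y then 1 else 0) / real N\<bar> \<le> 1 / real N"
proof -
  define r where "r = nat \<lfloor>real N * y\<rfloor>"
  have "real N * y \<le> real N" using assms by (simp add: mult_left_le)
  then have rN: "r \<le> N" by (simp add: r_def) linarith
  have r: "real r \<le> real N * y" "real N * y < real r + 1"
    using assms by (auto simp: r_def)
  have "(\<Sum>k\<in>{1..N}. if real k / real N \<le> y then 1 else (0::real))
      = real (card {k \<in> {1..N}. real k / real N \<le> y})"
    by (simp add: sum.If_cases Int_def)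
  also have "{k \<in> {1..N}. real k / real N \<le> y} = {1..r}"
  proof -
    have "real k / real N \<le> y \<longleftrightarrow> k \<le> r" for k
    proof -
      have "real k / real N \<le> y \<longleftrightarrow> real k \<le> real N * y" using N by (simp add: divide_le_eq mult.commute)
      also have "\<dots> \<longleftrightarrow> k \<le> r" using r by linarith
      finally show ?thesis .
    qed
    then have "{k \<in> {1..N}. real k / real N \<le> y} = {k \<in> {1..N}. k \<le> r}" by (simp only:)
    also have "\<dots> = {1..r}" using rN by auto
    finally show ?thesis .
  qed
  finally have "y - (\<Sum>k\<in>{1..N}. if real k / real N \<le> y then 1 else 0) / real N
      = (real N * y - real r) / real N"
    using N by (simp add: diff_divide_distrib)
  then have "\<bar>y - (\<Sum>k\<in>{1..N}. if real k / real N \<le> y then 1 else 0) / real N\<bar>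
      = \<bar>real N * y - real r\<bar> / real N"
    by simp
  also have "\<dots> \<le> 1 / real N" using r by (intro divide_right_mono) auto
  finally show ?thesis .
qed

text \<open>
  Any bound that is linear in the empirical and the true measure passes from intervals to
  functions: a superlevel set is a disjoint union of \<open>q\<close> intervals, and \<open>g\<close> is a limit of averages
  of indicators of superlevel sets. The error term \<open>C\<close> is paid once per interval and averaged
  over the levels, hence the factor \<open>q\<close>. The coefficients \<open>u\<close> and \<open>v\<close> are arbitrary reals, so
  that upper and lower deviations are both covered.
\<close>

lemma (in real_distribution) linear_bound_intervals_imp_piecewise_unimodal:
  fixes x :: "'i \<Rightarrow> real" and g :: "real \<Rightarrow> real"
  assumes fin: "finite I"
    and bound: "\<And>S. is_interval S \<Longrightarrow> u * (\<Sum>i\<in>I. indicat_real S (x i)) + v * measure M S \<le> C"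
    and g: "piecewise_unimodal q g" and g01: "\<And>z. g z \<in> {0..1}"
  shows "u * (\<Sum>i\<in>I. g (x i)) + v * (\<integral>z. g z \<partial>M) \<le> real q * C"
proof -
  obtain P where P: "disjoint_family_on P {1..q}" "(\<Union>j\<in>{1..q}. P j) = UNIV"
    "\<And>j t. j \<in> {1..q} \<Longrightarrow> is_interval {z \<in> P j. t \<le> g z}"
    using g by (auto simp: piecewise_unimodal_def)
  have gm[measurable]: "g \<in> borel_measurable borel"
    by (rule piecewise_unimodal_borel_measurable[OF g])
  have gint: "integrable M g"
    by (rule integrable_const_bound[where B = 1]) (use g01 in \<open>auto simp: abs_le_iff\<close>)
  let ?S = "\<lambda>j t. {z \<in> P j. t \<le> g z}"
  have meas: "?S j t \<in> sets borel" if "j \<in> {1..q}" for j t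
    by (rule real_interval_borel_measurable[OF P(3)[OF that]])
  define gN where "gN N z = (\<Sum>k\<in>{1..N}. \<Sum>j\<in>{1..q}. indicat_real (?S j (real k / real N)) z) / real N"
    for N z
  have pieces: "(\<Sum>j\<in>{1..q}. indicat_real (?S j t) z) = (if t \<le> g z then 1 else 0)" for t z
  proof -
    obtain j0 where j0: "j0 \<in> {1..q}" "z \<in> P j0" using P(2) by blast
    have "z \<in> P j \<longleftrightarrow> j = j0" if "j \<in> {1..q}" for j
      using P(1) j0 that unfolding disjoint_family_on_def by blast
    then have "(\<Sum>j\<in>{1..q}. indicat_real (?S j t) z) =
        (\<Sum>j\<in>{1..q}. if j = j0 then (if t \<le> g z then 1 else 0) else 0)"
      by (intro sum.cong refl) (auto simp: indicator_def)
    then show ?thesis using j0 by simp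
  qed
  have approx: "\<bar>g z - gN N z\<bar> \<le> 1 / real N" if "0 < N" for N z
    unfolding gN_def pieces using g01[of z] that by (intro layer_cake_sum_approx) auto
  have le: "u * (\<Sum>i\<in>I. g (x i)) + v * (\<integral>z. g z \<partial>M)
      \<le> real q * C + (\<bar>u\<bar> * real (card I) + \<bar>v\<bar>) / real N" if N: "0 < N" for N
  proof -
    have gNint: "integrable M (gN N)"
      unfolding gN_def using meas
      by (intro Bochner_Integration.integrable_divide Bochner_Integration.integrable_sum)
        (auto simp: less_top[symmetric])
    have "(\<integral>z. gN N z \<partial>M)
        = (\<Sum>k\<in>{1..N}. \<Sum>j\<in>{1..q}. measure M (?S j (real k / real N))) / real N"
    proof -
      have int: "integrable M (indicat_real (?S j t))" if "j \<in> {1..q}" for j t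
        using meas[OF that] by (simp add: less_top[symmetric])
      have "(\<integral>z. (\<Sum>k\<in>{1..N}. \<Sum>j\<in>{1..q}. indicat_real (?S j (real k / real N)) z) \<partial>M)
          = (\<Sum>k\<in>{1..N}. \<integral>z. (\<Sum>j\<in>{1..q}. indicat_real (?S j (real k / real N)) z) \<partial>M)"
        by (intro Bochner_Integration.integral_sum Bochner_Integration.integrable_sum int)
      also have "\<dots> = (\<Sum>k\<in>{1..N}. \<Sum>j\<in>{1..q}. measure M (?S j (real k / real N)))"
      proof (intro sum.cong refl)
        fix k
        have "(\<integral>z. (\<Sum>j\<in>{1..q}. indicat_real (?S j (real k / real N)) z) \<partial>M)
            = (\<Sum>j\<in>{1..q}. \<integral>z. indicat_real (?S j (real k / real N)) z \<partial>M)"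
          by (intro Bochner_Integration.integral_sum int)
        then show "(\<integral>z. (\<Sum>j\<in>{1..q}. indicat_real (?S j (real k / real N)) z) \<partial>M)
            = (\<Sum>j\<in>{1..q}. measure M (?S j (real k / real N)))" by simp
      qed
      finally show ?thesis unfolding gN_def by simp
    qed
    moreover have "(\<Sum>i\<in>I. gN N (x i))
        = (\<Sum>k\<in>{1..N}. \<Sum>j\<in>{1..q}. \<Sum>i\<in>I. indicat_real (?S j (real k / real N)) (x i)) / real N"
    proof -
      have "(\<Sum>i\<in>I. \<Sum>k\<in>{1..N}. \<Sum>j\<in>{1..q}. indicat_real (?S j (real k / real N)) (x i))
          = (\<Sum>k\<in>{1..N}. \<Sum>i\<in>I. \<Sum>j\<in>{1..q}. indicat_real (?S j (real k / real N)) (x i))"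
        by (rule sum.swap)
      also have "\<dots> = (\<Sum>k\<in>{1..N}. \<Sum>j\<in>{1..q}. \<Sum>i\<in>I. indicat_real (?S j (real k / real N)) (x i))"
        by (intro sum.cong refl sum.swap)
      finally show ?thesis by (simp add: gN_def sum_divide_distrib[symmetric])
    qed
    ultimately have "u * (\<Sum>i\<in>I. gN N (x i)) + v * (\<integral>z. gN N z \<partial>M)
        = (\<Sum>k\<in>{1..N}. \<Sum>j\<in>{1..q}. u * (\<Sum>i\<in>I. indicat_real (?S j (real k / real N)) (x i))
            + v * measure M (?S j (real k / real N))) / real N"
      by (simp add: sum.distrib sum_distrib_left add_divide_distrib)
    also have "\<dots> \<le> (\<Sum>k\<in>{1..N}. \<Sum>j\<in>{1..q}. C) / real N"
      using bound[OF P(3)] by (intro divide_right_mono sum_mono) auto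
    also have "\<dots> = real q * C" using N by simp
    finally have 1: "u * (\<Sum>i\<in>I. gN N (x i)) + v * (\<integral>z. gN N z \<partial>M) \<le> real q * C" .
    have "\<bar>(\<Sum>i\<in>I. g (x i)) - (\<Sum>i\<in>I. gN N (x i))\<bar> \<le> (\<Sum>i\<in>I. \<bar>g (x i) - gN N (x i)\<bar>)"
      unfolding sum_subtractf[symmetric] by (rule sum_abs)
    also have "\<dots> \<le> (\<Sum>i\<in>I. 1 / real N)" by (intro sum_mono approx N)
    finally have "\<bar>u\<bar> * \<bar>(\<Sum>i\<in>I. g (x i)) - (\<Sum>i\<in>I. gN N (x i))\<bar> \<le> \<bar>u\<bar> * (real (card I) / real N)"
      by (intro mult_left_mono) auto
    then have 2: "u * (\<Sum>i\<in>I. g (x i)) - u * (\<Sum>i\<in>I. gN N (x i)) \<le> \<bar>u\<bar> * (real (card I) / real N)"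
      unfolding abs_mult[symmetric] right_diff_distrib by linarith
    have "\<bar>(\<integral>z. g z \<partial>M) - (\<integral>z. gN N z \<partial>M)\<bar> \<le> (\<integral>z. \<bar>g z - gN N z\<bar> \<partial>M)"
      unfolding Bochner_Integration.integral_diff[OF gint gNint, symmetric]
      by (rule integral_abs_bound)
    also have "\<dots> \<le> (\<integral>z. 1 / real N \<partial>M)"
      using gint gNint by (intro integral_mono approx N) auto
    also have "\<dots> = 1 / real N" using prob_space by simp
    finally have "\<bar>v\<bar> * \<bar>(\<integral>z. g z \<partial>M) - (\<integral>z. gN N z \<partial>M)\<bar> \<le> \<bar>v\<bar> * (1 / real N)"
      by (intro mult_left_mono) auto
    then have "v * (\<integral>z. g z \<partial>M) - v * (\<integral>z. gN N z \<partial>M) \<le> \<bar>v\<bar> * (1 / real N)"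
      unfolding abs_mult[symmetric] right_diff_distrib by linarith
    with 1 2 show ?thesis by (simp add: add_divide_distrib)
  qed
  have "(\<lambda>N. real q * C + (\<bar>u\<bar> * real (card I) + \<bar>v\<bar>) / real N) \<longlonglongrightarrow> real q * C + 0"
    by (intro tendsto_intros lim_const_over_n)
  then have "u * (\<Sum>i\<in>I. g (x i)) + v * (\<integral>z. g z \<partial>M) \<le> real q * C + 0"
  proof (rule LIMSEQ_le_const)
    show "\<exists>N0. \<forall>N\<ge>N0. u * (\<Sum>i\<in>I. g (x i)) + v * (\<integral>z. g z \<partial>M)
        \<le> real q * C + (\<bar>u\<bar> * real (card I) + \<bar>v\<bar>) / real N"
      by (intro exI[of _ 1] allI impI le) simp
  qed
  then show ?thesis by simp
qed

text \<open>
  Summing square-root bounds over the pieces and averaging them over the levels would take the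
  Cauchy-Schwarz and Jensen inequalities. By the arithmetic-geometric mean inequality each of them
  is equivalent to a family of linear bounds with a free parameter \<open>t\<close>, which are simply added.
\<close>

lemma (in real_distribution) piecewise_unimodal_sum_deviation:
  fixes x :: "'i \<Rightarrow> real" and g :: "real \<Rightarrow> real"
  assumes fin: "finite I" and l: "0 \<le> l"
    and dev: "\<And>S. is_interval S \<Longrightarrow> \<bar>(\<Sum>i\<in>I. indicat_real S (x i)) - real n * measure M S\<bar>
      \<le> 2 * sqrt (real n * measure M S * l) + 4 * l"
    and g: "piecewise_unimodal q g" and g01: "\<And>z. g z \<in> {0..1}" and t: "0 < t"
  shows "\<bar>(\<Sum>i\<in>I. g (x i)) - real n * (\<integral>z. g z \<partial>M)\<bar>
    \<le> t * (real n * (\<integral>z. g z \<partial>M)) + real q * (l / t + 4 * l)"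
proof -
  have lin: "\<bar>(\<Sum>i\<in>I. indicat_real S (x i)) - real n * measure M S\<bar>
      \<le> t * (real n * measure M S) + (l / t + 4 * l)" if "is_interval S" for S
  proof -
    have "sqrt (real n * measure M S * l) = sqrt ((t * (real n * measure M S)) * (l / t))"
      using t by simp
    also have "\<dots> \<le> (t * (real n * measure M S) + l / t) / 2"
      using t l by (intro arith_geo_mean_sqrt) auto
    finally show ?thesis using dev[OF that] by simp
  qed
  have "1 * (\<Sum>i\<in>I. g (x i)) + (- (1 + t) * real n) * (\<integral>z. g z \<partial>M) \<le> real q * (l / t + 4 * l)"
    by (rule linear_bound_intervals_imp_piecewise_unimodal[OF fin _ g g01])
      (use lin in \<open>fastforce simp: algebra_simps abs_le_iff\<close>)
  moreover have "(- 1) * (\<Sum>i\<in>I. g (x i)) + ((1 - t) * real n) * (\<integral>z. g z \<partial>M) \<le> real q * (l / t + 4 * l)"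
    by (rule linear_bound_intervals_imp_piecewise_unimodal[OF fin _ g g01])
      (use lin in \<open>fastforce simp: algebra_simps abs_le_iff\<close>)
  ultimately show ?thesis by (simp add: abs_le_iff algebra_simps)
qed

text \<open>
  The way back from the linear bounds to a square root, now with the smaller of the two
  quantities under it. If \<open>a < b\<close>, the bound at the optimal \<open>t\<close> is a quadratic inequality for
  \<open>sqrt b\<close>, which gives \<open>sqrt b \<le> sqrt a + 3.5 * sqrt B\<close>.
\<close>

lemma abs_diff_le_sqrt_min:
  fixes a b B :: real
  assumes a: "0 \<le> a" and b: "0 \<le> b" and B: "0 < B"
    and lin: "\<And>t. 0 < t \<Longrightarrow> \<bar>a - b\<bar> \<le> t * b + B / t + 4 * B"
  shows "\<bar>a - b\<bar> \<le> 2 * sqrt (B * min a b) + 12 * B"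
proof -
  define r x y where "r = sqrt B" and "x = sqrt a" and "y = sqrt b"
  have sq: "B = r\<^sup>2" "a = x\<^sup>2" "b = y\<^sup>2" and nn: "0 < r" "0 \<le> x" "0 \<le> y"
    using a b B by (auto simp: r_def x_def y_def)
  have opt: "\<bar>a - b\<bar> \<le> 2 * (r * y) + 5 * r\<^sup>2"
  proof (cases "y = 0")
    case True
    then show ?thesis using lin[of 1] unfolding sq by simp
  next
    case False
    then have y: "0 < y" using nn by simp
    have "r / y * b = r * y" "B / (r / y) = r * y"
      using y nn unfolding sq by (simp_all add: power2_eq_square)
    then have "\<bar>a - b\<bar> \<le> 2 * (r * y) + 4 * B" using lin[of "r / y"] y nn by simp
    then show ?thesis using sq(1) zero_le_power2[of r] by linarith
  qed
  show ?thesis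
  proof (cases "b \<le> a")
    case True
    then have "sqrt (B * min a b) = r * y" by (simp add: real_sqrt_mult r_def y_def min_def)
    then show ?thesis using opt sq(1) zero_le_power2[of r] by linarith
  next
    case False
    then have m: "sqrt (B * min a b) = r * x" by (simp add: real_sqrt_mult r_def x_def min_def)
    \<comment> \<open>Otherwise \<open>(y - r)\<^sup>2\<close> would exceed \<open>x\<^sup>2 + 6 * r\<^sup>2\<close>, since the square of 2.5 is more than 6.\<close>
    have "y \<le> x + 3.5 * r"
    proof (rule ccontr)
      assume "\<not> y \<le> x + 3.5 * r"
      then have "(x + 2.5 * r)\<^sup>2 \<le> (y - r)\<^sup>2" using nn by (intro power_mono) auto
      moreover have "(y - r)\<^sup>2 \<le> x\<^sup>2 + 6 * r\<^sup>2"
        using opt False unfolding sq by (simp add: power2_eq_square algebra_simps)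
      moreover have "0 \<le> r * x" "0 < r * r" using nn by auto
      ultimately show False by (simp add: power2_eq_square algebra_simps)
    qed
    then have "r * y \<le> r * (x + 3.5 * r)" using nn by (intro mult_left_mono) auto
    then have "2 * (r * y) + 5 * r\<^sup>2 \<le> 2 * (r * x) + 12 * r\<^sup>2"
      by (simp add: power2_eq_square algebra_simps)
    then show ?thesis using opt m sq(1) by linarith
  qed
qed

section \<open>The uniform event\<close>

text \<open>
  Chernoff's bound and a union bound over the \<open>(n + 1)\<^sup>2\<close> differences of quantile down-sets. The
  choice \<open>l = 2 * ln (3 * n / \<delta>)\<close> makes \<open>exp (- l)\<close> of order \<open>1 / n\<^sup>2\<close>.
\<close>

lemma (in prob_space) uniform_interval_deviation:
  fixes X :: "'i \<Rightarrow> 'a \<Rightarrow> real" and \<mu> :: "real measure"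
  assumes indep: "indep_vars (\<lambda>_. borel) X I" and fin: "finite I" and ne: "I \<noteq> {}"
    and law: "\<And>i. i \<in> I \<Longrightarrow> distr M borel (X i) = \<mu>"
    and atomless: "\<And>z. measure \<mu> {z} = 0"
    and \<delta>: "0 < \<delta>" "\<delta> \<le> 1"
  defines "n \<equiv> real (card I)"
  defines "l \<equiv> 2 * ln (3 * n / \<delta>)"
  obtains E where "E \<in> events" "1 - 2 * \<delta> \<le> prob E"
    "\<And>\<omega> S. \<omega> \<in> E \<Longrightarrow> is_interval S \<Longrightarrow>
      \<bar>(\<Sum>i\<in>I. indicat_real S (X i \<omega>)) - n * measure \<mu> S\<bar> \<le> 2 * sqrt (n * measure \<mu> S * l) + 4 * l"
proof -
  have X[measurable]: "X i \<in> borel_measurable M" if "i \<in> I" for i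
    using indep that by (auto simp: indep_vars_def)
  interpret \<mu>: real_distribution \<mu>
  proof -
    obtain i where "i \<in> I" using ne by auto
    then show "real_distribution \<mu>" using law[of i] X by (metis real_distribution_distr)
  qed
  have n: "1 \<le> n" "0 < card I" using fin ne by (auto simp: n_def card_gt_0_iff Suc_le_eq)
  have \<delta>n: "3 \<le> 3 * n / \<delta>" using n \<delta> by (simp add: le_divide_eq)
  have "1 \<le> ln (3::real)" using exp_le by (simp add: ln_ge_iff)
  also have "\<dots> \<le> ln (3 * n / \<delta>)" using \<delta>n by (subst ln_le_cancel_iff) auto
  finally have l: "2 \<le> l" by (simp add: l_def)
  obtain D where D: "D 0 = {}" "D (card I) = UNIV" "\<And>i. D i \<in> sets borel"
    "\<And>i x y. y \<in> D i \<Longrightarrow> x \<le> y \<Longrightarrow> x \<in> D i"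
    "\<And>i. i \<le> card I \<Longrightarrow> measure \<mu> (D i) = real i / real (card I)"
    by (rule \<mu>.quantile_down_sets[OF atomless n(2)]) blast
  note D(3)[measurable]
  define bad where "bad = (\<lambda>(i, j). {\<omega> \<in> space M.
    \<not> \<bar>(\<Sum>k\<in>I. indicat_real (D j - D i) (X k \<omega>)) - n * measure \<mu> (D j - D i)\<bar>
      \<le> 2 * sqrt (n * measure \<mu> (D j - D i) * l) + l})"
  let ?J = "{..card I} \<times> {..card I}"
  have bad_meas: "bad r \<in> events" for r
    unfolding bad_def by (cases r) simp
  have bad_prob: "prob (bad r) \<le> 2 * exp (- l)" for r
  proof -
    obtain i j where r: "r = (i, j)" by force
    have "prob (X k -` (D j - D i) \<inter> space M) = measure \<mu> (D j - D i)" if "k \<in> I" for k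
      unfolding law[OF that, symmetric] using X[OF that] by (subst measure_distr) auto
    from count_deviation[OF indep fin _ this] show ?thesis
      unfolding r bad_def n_def using l by simp
  qed
  have "prob (\<Union>r\<in>?J. bad r) \<le> (\<Sum>r\<in>?J. prob (bad r))"
    using bad_meas by (intro finite_measure_subadditive_finite) auto
  also have "\<dots> \<le> (\<Sum>r\<in>?J. 2 * exp (- l))" by (intro sum_mono bad_prob)
  also have "\<dots> = 2 * (n + 1)\<^sup>2 * exp (- l)"
    by (simp add: n_def power2_eq_square algebra_simps)
  also have "\<dots> \<le> 2 * (2 * n)\<^sup>2 * exp (- l)"
    using n by (intro mult_right_mono mult_left_mono power_mono) auto
  also have "exp (- l) = (\<delta> / (3 * n))\<^sup>2"
  proof -
    have "exp (- l) = inverse (exp (ln (3 * n / \<delta>)) * exp (ln (3 * n / \<delta>)))"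
      by (simp add: l_def exp_minus exp_add[symmetric])
    also have "\<dots> = inverse (3 * n / \<delta> * (3 * n / \<delta>))"
      using n \<delta> by simp
    finally show ?thesis by (simp add: power2_eq_square)
  qed
  also have "2 * (2 * n)\<^sup>2 * (\<delta> / (3 * n))\<^sup>2 = 8 / 9 * (\<delta> * \<delta>)"
    using n by (simp add: power2_eq_square field_simps)
  also have "\<dots> \<le> 2 * \<delta>"
    using \<delta> mult_left_mono[of \<delta> 1 \<delta>] by simp
  finally have "prob (\<Union>r\<in>?J. bad r) \<le> 2 * \<delta>" .
  moreover have bads: "(\<Union>r\<in>?J. bad r) \<in> events" using bad_meas by (intro sets.finite_UN) auto
  ultimately have big: "1 - 2 * \<delta> \<le> prob (space M - (\<Union>r\<in>?J. bad r))"
    by (simp add: prob_compl)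
  have "space M - (\<Union>r\<in>?J. bad r) \<in> events" using bads by auto
  moreover note big
  moreover have "\<bar>(\<Sum>i\<in>I. indicat_real S (X i \<omega>)) - n * measure \<mu> S\<bar>
      \<le> 2 * sqrt (n * measure \<mu> S * l) + 4 * l"
    if \<omega>: "\<omega> \<in> space M - (\<Union>r\<in>?J. bad r)" and S: "is_interval S" for \<omega> S
    unfolding n_def
  proof (rule \<mu>.interval_count_deviation[OF fin ne D _ l S])
    fix i j assume "i \<le> card I" "j \<le> card I"
    then have "\<omega> \<notin> bad (i, j)" using \<omega> by blast
    then show "\<bar>(\<Sum>k\<in>I. indicat_real (D j - D i) (X k \<omega>)) - real (card I) * measure \<mu> (D j - D i)\<bar>
        \<le> 2 * sqrt (real (card I) * measure \<mu> (D j - D i) * l) + l"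
      using \<omega> by (simp add: bad_def n_def)
  qed
  ultimately show ?thesis by (rule that)
qed

section \<open>Application to the kernel density estimator\<close>

text \<open>
  The pieces are \<open>{a j<..a (j + 1)}\<close>, with the last one unbounded: the kernel increases up to
  \<open>b j\<close>, may jump there either way, and decreases afterwards.
\<close>

lemma kernel_piecewise_unimodal:
  assumes q: "1 \<le> q" and ep: "endpoints q a b"
    and A: "A = (\<Union>j\<in>{1..q}. inner_interval a b j)"
    and F: "\<And>j. j \<in> {1..q} \<Longrightarrow> mono_on (inner_interval a b j) F"
    and G: "\<And>j. j \<in> {1..q} \<Longrightarrow> mono_on (outer_interval q a b j) G"
    and K: "\<And>u. K u = F u * indicat_real A u + (1 - G u) * indicat_real (- A) u"
  shows "piecewise_unimodal q K"
proof -
  have a1: "a 1 = - \<infinity>" and ab: "\<And>j. j \<in> {1..q} \<Longrightarrow> a j < ereal (b j)"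
    and ba: "\<And>j. j \<in> {1..<q} \<Longrightarrow> ereal (b j) < a (j + 1)"
    using ep by (auto simp: endpoints_def)
  define C where "C j = inner_interval a b j \<union> outer_interval q a b j" for j
  have C: "u \<in> C j \<longleftrightarrow> a j < ereal u \<and> (j < q \<longrightarrow> ereal u \<le> a (j + 1))" if j: "j \<in> {1..q}" for u j
  proof -
    have "a j < ereal u" if "b j < u" using ab[OF j] that by (metis ereal_less(1) less_ereal.simps(1) less_trans)
    moreover have "ereal u \<le> a (j + 1)" if "u \<le> b j" "j < q"
      using ba[of j] that j by (metis atLeastLessThan_iff atLeastAtMost_iff ereal_less_eq(3) le_less_trans less_imp_le)
    moreover have "j = q" if "\<not> j < q" using j that by simp
    ultimately show ?thesis
      by (auto simp: C_def inner_interval_def outer_interval_def not_le)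
  qed
  have a_step: "a j \<le> a (j + 1)" if "j \<in> {1..<q}" for j
    using ab[of j] ba[OF that] that by fastforce
  have a_mono: "a i \<le> a j" if "1 \<le> i" "i \<le> j" "j \<le> q" for i j
    using that(2,3)
  proof (induction j rule: dec_induct)
    case (step k)
    then show ?case using a_step[of k] that(1) by (auto intro: order_trans)
  qed simp
  have "\<not> (u \<in> C i \<and> u \<in> C j)" if "i < j" "i \<in> {1..q}" "j \<in> {1..q}" for i j u
    using that a_mono[of "i + 1" j] C[of i u] C[of j u] by (auto simp: not_less)
  then have disj: "i = j" if "u \<in> C i" "u \<in> C j" "i \<in> {1..q}" "j \<in> {1..q}" for i j u
    using that by (meson linorder_neqE_nat)
  have cover: "\<exists>j\<in>{1..q}. u \<in> C j" for u
  proof -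
    let ?J = "{j \<in> {1..q}. a j < ereal u}"
    have J: "finite ?J" "1 \<in> ?J" using q a1 by auto
    define j where "j = Max ?J"
    have j: "j \<in> ?J" unfolding j_def using J by (intro Max_in) auto
    have "ereal u \<le> a (j + 1)" if "j < q"
    proof (rule ccontr)
      assume "\<not> ?thesis"
      then have "j + 1 \<in> ?J" using that by auto
      then have "j + 1 \<le> j" unfolding j_def using J by (intro Max_ge) auto
      then show False by simp
    qed
    then show ?thesis using C[of j u] j by auto
  qed
  have K_inner: "K u = F u" if "u \<in> inner_interval a b j" "j \<in> {1..q}" for u j
    using that by (auto simp: K A indicator_def)
  have K_outer: "K u = 1 - G u" if u: "u \<in> outer_interval q a b j" and j: "j \<in> {1..q}" for u j
  proof -
    have "u \<notin> inner_interval a b i" if i: "i \<in> {1..q}" for i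
    proof
      assume "u \<in> inner_interval a b i"
      moreover from this have "i = j" using disj[of u i j] u i j by (simp add: C_def)
      moreover have "j = q" if "\<not> j < q" using j that by simp
      ultimately show False using u by (auto simp: inner_interval_def outer_interval_def split: if_splits)
    qed
    then show ?thesis by (auto simp: K A indicator_def)
  qed
  have "is_interval {z \<in> C j. t \<le> K z}" if j: "j \<in> {1..q}" for j t
    unfolding is_interval_1
  proof (intro ballI allI impI)
    fix u v w assume u: "u \<in> {z \<in> C j. t \<le> K z}" and v: "v \<in> {z \<in> C j. t \<le> K z}"
      and w: "u \<le> w \<and> w \<le> v"
    have wC: "w \<in> C j"
    proof -
      have "a j < ereal u" "j < q \<Longrightarrow> ereal v \<le> a (j + 1)"
        using u v C[OF j, of u] C[OF j, of v] by auto
      moreover have "ereal u \<le> ereal w" "ereal w \<le> ereal v" using w by auto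
      ultimately show ?thesis
        unfolding C[OF j] by (blast intro: less_le_trans order_trans)
    qed
    show "w \<in> {z \<in> C j. t \<le> K z}"
    proof (cases "w \<in> inner_interval a b j")
      case True
      then have ui: "u \<in> inner_interval a b j"
        using u w C[OF j, of u] by (auto simp: inner_interval_def)
      have "K u \<le> K w"
        using mono_onD[OF F[OF j] ui True] w K_inner[OF ui j] K_inner[OF True j] by simp
      then show ?thesis using u wC by simp
    next
      case False
      then have wo: "w \<in> outer_interval q a b j" using wC by (simp add: C_def)
      have vo: "v \<in> outer_interval q a b j"
      proof (rule ccontr)
        assume "v \<notin> outer_interval q a b j"
        then have "v \<in> inner_interval a b j" using v by (simp add: C_def)
        then have "w \<in> inner_interval a b j"
          using w C[OF j, of w] wC by (auto simp: inner_interval_def)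
        then show False using False by simp
      qed
      have "K v \<le> K w"
        using mono_onD[OF G[OF j] wo vo] w K_outer[OF wo j] K_outer[OF vo j] by simp
      then show ?thesis using v wC by simp
    qed
  qed
  moreover have "disjoint_family_on C {1..q}"
    unfolding disjoint_family_on_def using disj by blast
  moreover have "(\<Union>j\<in>{1..q}. C j) = UNIV" using cover by blast
  ultimately show ?thesis unfolding piecewise_unimodal_def by blast
qed

lemma kde_eq_sum: "kde K n h xs x = (\<Sum>i\<in>{1..n}. K ((x - xs i) / h)) / (real n * h)"
  by (simp add: kde_def scaled_kernel_def divide_inverse sum_distrib_left[symmetric] mult_ac)

lemma smoothed_density_eq_integral:
  assumes "f \<in> borel_measurable borel" "K \<in> borel_measurable borel" "\<And>z. 0 \<le> f z"
  shows "smoothed_density f K h x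
    = (\<integral>z. K ((x - z) / h) \<partial>density lborel (\<lambda>z. ennreal (f z))) / h"
proof -
  note assms(1,2)[measurable]
  have "smoothed_density f K h x = (\<integral>z. f z * scaled_kernel K h (x - z) \<partial>lborel)"
    unfolding smoothed_density_def
    by (subst lborel_integral_real_affine[where c = "-1" and t = x]) auto
  also have "\<dots> = (\<integral>z. scaled_kernel K h (x - z) \<partial>density lborel (\<lambda>z. ennreal (f z)))"
    using assms(3) unfolding scaled_kernel_def by (subst integral_real_density) auto
  finally show ?thesis by (simp add: scaled_kernel_def divide_inverse mult.commute)
qed

text \<open>
  The kernel enters only through the fact that \<open>\<lambda>z. K ((x - z) / h)\<close> is piecewise unimodal for
  every \<open>x\<close> and \<open>h\<close>, so a single event serves all locations and all bandwidths at once.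
\<close>

lemma (in prob_space) kde_uniform_deviation:
  fixes X :: "nat \<Rightarrow> 'a \<Rightarrow> real" and f K :: "real \<Rightarrow> real"
  assumes indep: "indep_vars (\<lambda>_. borel) X {1..n}" and n: "1 \<le> n"
    and dist: "\<And>i. i \<in> {1..n} \<Longrightarrow> distributed M lborel (X i) (\<lambda>x. ennreal (f x))"
    and f: "\<And>x. 0 \<le> f x" and \<delta>: "0 < \<delta>" "\<delta> \<le> 1"
    and K: "piecewise_unimodal q K" and K01: "\<And>u. K u \<in> {0..1}" and q: "1 \<le> q"
  obtains E where "E \<in> events" "1 - 2 * \<delta> \<le> prob E"
    "\<And>\<omega> x h c d. \<omega> \<in> E \<Longrightarrow> 0 < h \<Longrightarrow> 24 \<le> c \<Longrightarrow> 72 \<le> d \<Longrightarrow>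
      \<bar>kde K n h (\<lambda>i. X i \<omega>) x - smoothed_density f K h x\<bar>
        \<le> sqrt (c * real q / (real n * h)
                 * min (kde K n h (\<lambda>i. X i \<omega>) x) (smoothed_density f K h x)
                 * ln (3 * real n / \<delta>))
          + d * real q / (real n * h) * ln (3 * real n / \<delta>)"
proof -
  define \<mu> where "\<mu> = density lborel (\<lambda>x. ennreal (f x))"
  have one: "1 \<in> {1..n}" using n by simp
  have law: "distr M borel (X i) = \<mu>" if "i \<in> {1..n}" for i
    using distributed_distr_eq_density[OF dist[OF that]] unfolding \<mu>_def
    by (metis distr_cong sets_lborel)
  have "(\<lambda>x. ennreal (f x)) \<in> borel_measurable lborel"
    using distributed_borel_measurable[OF dist[OF one]] .
  then have "(\<lambda>x. enn2real (ennreal (f x))) \<in> borel_measurable borel" by simp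
  then have fm[measurable]: "f \<in> borel_measurable borel" using f by simp
  have Km[measurable]: "K \<in> borel_measurable borel" by (rule piecewise_unimodal_borel_measurable[OF K])
  have "X 1 \<in> borel_measurable M" using distributed_measurable[OF dist[OF one]] by simp
  then interpret \<mu>: real_distribution \<mu>
    unfolding law[OF one, symmetric] by (rule real_distribution_distr)
  have atomless: "measure \<mu> {z} = 0" for z
  proof -
    have "AE y in lborel. y \<in> {z} \<longrightarrow> ennreal (f y) = 0"
      using AE_lborel_singleton[of z] by (rule eventually_mono) simp
    then have "{z} \<in> null_sets \<mu>"
      unfolding \<mu>_def by (subst null_sets_density_iff) auto
    then show ?thesis by (simp add: measure_eq_0_null_sets)
  qed
  define l where "l = 2 * ln (3 * real n / \<delta>)"
  have l: "0 < l" using n \<delta> by (simp add: l_def ln_gt_zero less_divide_eq)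
  obtain E where E: "E \<in> events" "1 - 2 * \<delta> \<le> prob E"
    "\<And>\<omega> S. \<omega> \<in> E \<Longrightarrow> is_interval S \<Longrightarrow>
      \<bar>(\<Sum>i\<in>{1..n}. indicat_real S (X i \<omega>)) - real n * measure \<mu> S\<bar>
        \<le> 2 * sqrt (real n * measure \<mu> S * l) + 4 * l"
    using uniform_interval_deviation[OF indep _ _ law atomless \<delta>] n
    unfolding l_def by (auto simp del: One_nat_def)
  show ?thesis
  proof (rule that[OF E(1,2)])
    fix \<omega> x h c d assume \<omega>: "\<omega> \<in> E" and h: "0 < (h::real)" and c: "24 \<le> (c::real)" and d: "72 \<le> (d::real)"
    define g where "g z = K ((x - z) / h)" for z
    have g: "piecewise_unimodal q g" "\<And>z. g z \<in> {0..1}"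
      unfolding g_def using piecewise_unimodal_reflect_scale[OF K h] K01 by auto
    define s e where "s = (\<Sum>i\<in>{1..n}. g (X i \<omega>))" and "e = (\<integral>z. g z \<partial>\<mu>)"
    have s0: "0 \<le> s" unfolding s_def using g(2) by (intro sum_nonneg) auto
    have e0: "0 \<le> e" unfolding e_def using g(2) by (intro Bochner_Integration.integral_nonneg) auto
    have nh: "0 < real n * h" using n h by simp
    define A where "A = kde K n h (\<lambda>i. X i \<omega>) x"
    define S where "S = smoothed_density f K h x"
    have A: "A = s / (real n * h)" by (simp add: A_def kde_eq_sum s_def g_def)
    have S: "S = e / h"
      unfolding S_def using smoothed_density_eq_integral[OF fm Km f] by (simp add: e_def g_def \<mu>_def)
    have A0: "0 \<le> A" and S0: "0 \<le> S" using s0 e0 nh h by (auto simp: A S)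
    define B where "B = real q * l / (real n * h)"
    have B: "0 < B" using q l nh by (simp add: B_def)
    have "\<bar>A - S\<bar> \<le> t * S + B / t + 4 * B" if t: "0 < t" for t
    proof -
      have "\<bar>s - real n * e\<bar> \<le> t * (real n * e) + real q * (l / t + 4 * l)"
        unfolding s_def e_def
        by (rule \<mu>.piecewise_unimodal_sum_deviation[OF _ _ E(3)[OF \<omega>] g t]) (use l in auto)
      then have "\<bar>s - real n * e\<bar> / (real n * h)
          \<le> (t * (real n * e) + real q * (l / t + 4 * l)) / (real n * h)"
        using nh by (intro divide_right_mono) auto
      moreover have "\<bar>s - real n * e\<bar> / (real n * h) = \<bar>(s - real n * e) / (real n * h)\<bar>"
        using nh by (simp only: abs_divide abs_of_pos)
      moreover have "(s - real n * e) / (real n * h) = A - S"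
        using n by (simp add: A S diff_divide_distrib)
      moreover have "(t * (real n * e) + real q * (l / t + 4 * l)) / (real n * h) = t * S + B / t + 4 * B"
        using n by (simp add: S B_def add_divide_distrib distrib_left mult_ac)
      ultimately show ?thesis by simp
    qed
    then have "\<bar>A - S\<bar> \<le> 2 * sqrt (B * min A S) + 12 * B"
      by (rule abs_diff_le_sqrt_min[OF A0 S0 B])
    also have "2 * sqrt (B * min A S) = sqrt (4 * B * min A S)" by (simp add: real_sqrt_mult)
    also have "\<dots> \<le> sqrt (c * real q / (real n * h) * min A S * ln (3 * real n / \<delta>))"
    proof (rule real_sqrt_le_mono)
      have "8 * (B / 2 * min A S) \<le> c * (B / 2 * min A S)"
        using c A0 S0 B by (intro mult_right_mono) auto
      then show "4 * B * min A S \<le> c * real q / (real n * h) * min A S * ln (3 * real n / \<delta>)"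
        by (simp add: B_def l_def mult_ac)
    qed
    also have "12 * B \<le> d * real q / (real n * h) * ln (3 * real n / \<delta>)"
    proof -
      have "24 * (B / 2) \<le> d * (B / 2)" using d B by (intro mult_right_mono) auto
      then show ?thesis by (simp add: B_def l_def mult_ac)
    qed
    finally show "\<bar>kde K n h (\<lambda>i. X i \<omega>) x - smoothed_density f K h x\<bar>
        \<le> sqrt (c * real q / (real n * h)
                 * min (kde K n h (\<lambda>i. X i \<omega>) x) (smoothed_density f K h x)
                 * ln (3 * real n / \<delta>))
          + d * real q / (real n * h) * ln (3 * real n / \<delta>)"
      by (simp add: A_def S_def)
  qed
qed

lemma kde_borel_measurable:
  assumes "K \<in> borel_measurable borel" "\<And>i. i \<in> {1..n} \<Longrightarrow> X i \<in> borel_measurable M"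
  shows "(\<lambda>\<omega>. kde K n h (\<lambda>i. X i \<omega>) x) \<in> borel_measurable M"
  unfolding kde_eq_sum
  by (intro borel_measurable_divide borel_measurable_const borel_measurable_sum
      measurable_compose[OF _ assms(1)] borel_measurable_diff assms(2))

theorem theorem8:
  fixes M :: "'w measure"
    and X :: "nat \<Rightarrow> 'w \<Rightarrow> real"
    and f K F G :: "real \<Rightarrow> real"
    and n q :: nat
    and \<delta> :: real
    and a :: "nat \<Rightarrow> ereal"
    and b :: "nat \<Rightarrow> real"
    and A :: "real set"
  assumes "prob_space M"
    and "n \<ge> 1"
    and "0 < \<delta>" and "\<delta> < 1 / 4"
    and "prob_space.indep_vars M (\<lambda>_. borel) X {1..n}"
    and "\<And>x. 0 \<le> f x"
    and "\<And>i. i \<in> {1..n} \<Longrightarrow> distributed M lborel (X i) (\<lambda>x. ennreal (f x))"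
    and "q \<ge> 1"
    and "endpoints q a b"
    and "A = (\<Union>j\<in>{1..q}. inner_interval a b j)"
    and "\<And>u. F u \<in> {0..1}"
    and "\<And>u. G u \<in> {0..1}"
    and "\<And>j. j \<in> {1..q} \<Longrightarrow> mono_on (inner_interval a b j) F"
    and "\<And>j. j \<in> {1..q} \<Longrightarrow> mono_on (outer_interval q a b j) G"
    and "\<And>u. 0 \<le> K u"
    and "\<And>u. K u = F u * indicat_real A u + (1 - G u) * indicat_real (- A) u"
  shows
    "(\<forall>h D. 0 < h \<and> countable D \<and> closure D = UNIV \<longrightarrow>
        measure M {\<omega> \<in> space M. \<forall>x\<in>D.
          \<bar>kde K n h (\<lambda>i. X i \<omega>) x - smoothed_density f K h x\<bar>
          \<le> sqrt (24 * real q / (real n * h)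
                   * min (kde K n h (\<lambda>i. X i \<omega>) x) (smoothed_density f K h x)
                   * ln (3 * real n / \<delta>))
             + 72 * real q / (real n * h) * ln (3 * real n / \<delta>)}
        \<ge> 1 - 2 * \<delta>)
     \<and>
     ((\<forall>j\<in>{1..q}. left_continuous_on (inner_interval a b j) F) \<and>
      (\<forall>j\<in>{1..q}. right_continuous_on (outer_interval q a b j) G) \<longrightarrow>
      (\<forall>D'. countable D' \<and> D' \<subseteq> UNIV \<times> {0<..} \<and> UNIV \<times> {0<..} \<subseteq> closure D' \<longrightarrow>
        measure M {\<omega> \<in> space M. \<forall>(x, h)\<in>D'.
          \<bar>kde K n h (\<lambda>i. X i \<omega>) x - smoothed_density f K h x\<bar>
          \<le> sqrt (40 * real q / (real n * h)
                   * min (kde K n h (\<lambda>i. X i \<omega>) x) (smoothed_density f K h x)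
                   * ln (3 * real n / \<delta>))
             + 120 * real q / (real n * h) * ln (3 * real n / \<delta>)}
        \<ge> 1 - 2 * \<delta>))"
proof -
  interpret prob_space M by fact
  have K: "piecewise_unimodal q K"
    by (rule kernel_piecewise_unimodal[OF assms(8-10,13,14,16)])
  have K01: "K u \<in> {0..1}" for u
    using assms(11)[of u] assms(12)[of u] by (simp add: assms(16) indicator_def)
  let ?dev = "\<lambda>c d x h \<omega>. \<bar>kde K n h (\<lambda>i. X i \<omega>) x - smoothed_density f K h x\<bar>
    \<le> sqrt (c * real q / (real n * h)
             * min (kde K n h (\<lambda>i. X i \<omega>) x) (smoothed_density f K h x)
             * ln (3 * real n / \<delta>))
       + d * real q / (real n * h) * ln (3 * real n / \<delta>)"
  have "\<delta> \<le> 1" using assms(4) by simp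
  then obtain E where E: "E \<in> events" "1 - 2 * \<delta> \<le> prob E"
    "\<And>\<omega> x h c d. \<omega> \<in> E \<Longrightarrow> 0 < h \<Longrightarrow> 24 \<le> c \<Longrightarrow> 72 \<le> d \<Longrightarrow> ?dev c d x h \<omega>"
    using kde_uniform_deviation[OF assms(5,2,7,6,3) _ K K01 assms(8)] by blast
  have "X i \<in> borel_measurable M" if "i \<in> {1..n}" for i
    using distributed_measurable[OF assms(7)[OF that]] by simp
  note kde_meas = kde_borel_measurable[OF piecewise_unimodal_borel_measurable[OF K] this]
  have dev_meas: "{\<omega> \<in> space M. \<bar>Y \<omega> - s\<bar> \<le> sqrt (u * min (Y \<omega>) s * v) + w} \<in> events"
    if [measurable]: "Y \<in> borel_measurable M" for Y :: "'w \<Rightarrow> real" and s u v w :: real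
    by measurable
  \<comment> \<open>\<open>E\<close> does not depend on the points; their countability makes the event of the theorem
    measurable.\<close>
  have concl: "1 - 2 * \<delta> \<le> prob {\<omega> \<in> space M. \<forall>r\<in>R. ?dev c d (x r) (h r) \<omega>}"
    if R: "countable R" "\<And>r. r \<in> R \<Longrightarrow> 0 < h r" and cd: "24 \<le> c" "72 \<le> d"
    for R :: "'r set" and h x :: "'r \<Rightarrow> real" and c d :: real
  proof (rule order_trans[OF E(2)], rule finite_measure_mono)
    show "E \<subseteq> {\<omega> \<in> space M. \<forall>r\<in>R. ?dev c d (x r) (h r) \<omega>}"
    proof (intro subsetI CollectI conjI ballI)
      fix \<omega> r assume \<omega>: "\<omega> \<in> E" and r: "r \<in> R"
      show "?dev c d (x r) (h r) \<omega>" by (rule E(3)[OF \<omega> R(2)[OF r] cd])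
    qed (use sets.sets_into_space[OF E(1)] in blast)
    show "{\<omega> \<in> space M. \<forall>r\<in>R. ?dev c d (x r) (h r) \<omega>} \<in> events"
      by (intro sets.sets_Collect_countable_All' R(1) dev_meas kde_meas)
  qed
  show ?thesis
  proof (intro conjI impI allI)
    fix h :: real and D :: "real set"
    assume "0 < h \<and> countable D \<and> closure D = UNIV"
    then show "1 - 2 * \<delta> \<le> prob {\<omega> \<in> space M. \<forall>x\<in>D. ?dev 24 72 x h \<omega>}"
      by (intro concl) auto
  next
    fix D' :: "(real \<times> real) set"
    assume "countable D' \<and> D' \<subseteq> UNIV \<times> {0<..} \<and> UNIV \<times> {0<..} \<subseteq> closure D'"
    then have "1 - 2 * \<delta> \<le> prob {\<omega> \<in> space M. \<forall>r\<in>D'. ?dev 40 120 (fst r) (snd r) \<omega>}"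
      by (intro concl) auto
    then show "1 - 2 * \<delta> \<le> prob {\<omega> \<in> space M. \<forall>(x, h)\<in>D'. ?dev 40 120 x h \<omega>}"
      by (simp only: case_prod_unfold)
  qed
qed

end
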